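(* Let $n\ge1$ and $\alpha,\beta\in\mathcal{IC}_n$. Then, for the starred Green's relations on the semigroup $\mathcal{IC}_n$: (i) $\alpha\,\mathcal{L}^*\,\beta$ if and only if $\mathrm{Im}\,\alpha=\mathrm{Im}\,\beta$; (ii) $\alpha\,\mathcal{R}^*\,\beta$ if and only if $\mathrm{Dom}\,\alpha=\mathrm{Dom}\,\beta$; (iii) $\alpha\,\mathcal{H}^*\,\beta$ if and only if $\alpha=\beta$.
   Context: Let $[n]=\{1,2,\ldots,n\}$ with its usual order. $\mathcal{IC}_n$ is the monoid of all injective partial transformations $\alpha$ of $[n]$ (the empty map allowed) that are isotone ($x\le y$ implies $x\alpha\le y\alpha$ for all $x,y\in\mathrm{Dom}\,\alpha$) and order-decreasing ($x\alpha\le x$ for all $x\in \mathrm{Dom}\,\alpha$), maps being written on the right and composed left to right: $x(\alpha\beta)=(x\alpha)\beta$. For a semigroup $S$ and $a,b\in S$: $a\,\mathcal{L}^*\,b$ iff for all $x,y\in S^1$, $ax=ay\Leftrightarrow bx=by$; $a\,\mathcal{R}^*\,b$ iff for all $x,y\in S^1$, $xa=ya\Leftrightarrow xb=yb$; and $\mathcal{H}^*=\mathcal{L}^*\cap\mathcal{R}^*$. *)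

theory Defs
  imports Main
begin

text \<open>A semigroup is given by a carrier \<open>S\<close> and a binary operation \<open>m\<close>. The elements of \<open>S\<^sup>1\<close>
  live in the option type, with \<open>None\<close> the adjoined identity; it belongs to \<open>S\<^sup>1\<close> only if \<open>S\<close>
  has no identity of its own.\<close>

definition has_identity :: "'a set \<Rightarrow> ('a \<Rightarrow> 'a \<Rightarrow> 'a) \<Rightarrow> bool" where
  "has_identity S m \<longleftrightarrow> (\<exists>e\<in>S. \<forall>x\<in>S. m e x = x \<and> m x e = x)"

definition adjoin1 :: "'a set \<Rightarrow> ('a \<Rightarrow> 'a \<Rightarrow> 'a) \<Rightarrow> 'a option set" where
  "adjoin1 S m = (if has_identity S m then Some ` S else insert None (Some ` S))"

fun mult1 :: "('a \<Rightarrow> 'a \<Rightarrow> 'a) \<Rightarrow> 'a option \<Rightarrow> 'a option \<Rightarrow> 'a option" where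
  "mult1 m None y = y"
| "mult1 m (Some x) None = Some x"
| "mult1 m (Some x) (Some y) = Some (m x y)"

definition Lstar :: "'a set \<Rightarrow> ('a \<Rightarrow> 'a \<Rightarrow> 'a) \<Rightarrow> 'a rel" where
  "Lstar S m = {(a, b). a \<in> S \<and> b \<in> S \<and>
     (\<forall>x\<in>adjoin1 S m. \<forall>y\<in>adjoin1 S m.
        mult1 m (Some a) x = mult1 m (Some a) y \<longleftrightarrow> mult1 m (Some b) x = mult1 m (Some b) y)}"

definition Rstar :: "'a set \<Rightarrow> ('a \<Rightarrow> 'a \<Rightarrow> 'a) \<Rightarrow> 'a rel" where
  "Rstar S m = {(a, b). a \<in> S \<and> b \<in> S \<and>
     (\<forall>x\<in>adjoin1 S m. \<forall>y\<in>adjoin1 S m.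
        mult1 m x (Some a) = mult1 m y (Some a) \<longleftrightarrow> mult1 m x (Some b) = mult1 m y (Some b))}"

definition Hstar :: "'a set \<Rightarrow> ('a \<Rightarrow> 'a \<Rightarrow> 'a) \<Rightarrow> 'a rel" where
  "Hstar S m = Lstar S m \<inter> Rstar S m"

text \<open>Partial transformations are maps \<open>nat \<rightharpoonup> nat\<close>, undefined outside their domain; \<open>dom\<close> and
  \<open>ran\<close> are domain and image.\<close>

definition IC :: "nat \<Rightarrow> (nat \<rightharpoonup> nat) set" where
  "IC n = {\<alpha>. dom \<alpha> \<subseteq> {1..n} \<and> ran \<alpha> \<subseteq> {1..n} \<and> inj_on \<alpha> (dom \<alpha>) \<and>
     (\<forall>x\<in>dom \<alpha>. \<forall>y\<in>dom \<alpha>. x \<le> y \<longrightarrow> the (\<alpha> x) \<le> the (\<alpha> y)) \<and>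
     (\<forall>x\<in>dom \<alpha>. the (\<alpha> x) \<le> x)}"

text \<open>Maps act on the right, so the product \<open>\<alpha>\<beta>\<close> applies \<open>\<alpha>\<close> first, whereas \<open>\<circ>\<^sub>m\<close>
  applies its right argument first.\<close>

definition pcomp :: "(nat \<rightharpoonup> nat) \<Rightarrow> (nat \<rightharpoonup> nat) \<Rightarrow> (nat \<rightharpoonup> nat)" where
  "pcomp \<alpha> \<beta> = \<beta> \<circ>\<^sub>m \<alpha>"

lemma pcomp_eq_Some_iff: "pcomp \<alpha> \<beta> x = Some z \<longleftrightarrow> (\<exists>y. \<alpha> x = Some y \<and> \<beta> y = Some z)"
  by (simp add: pcomp_def map_comp_Some_iff)

lemma IC_iff: "\<alpha> \<in> IC n \<longleftrightarrow>
   (\<forall>x y. \<alpha> x = Some y \<longrightarrow> 1 \<le> y \<and> y \<le> x \<and> x \<le> n) \<and>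
   (\<forall>x x' y. \<alpha> x = Some y \<longrightarrow> \<alpha> x' = Some y \<longrightarrow> x = x') \<and>
   (\<forall>x x' y y'. \<alpha> x = Some y \<longrightarrow> \<alpha> x' = Some y' \<longrightarrow> x \<le> x' \<longrightarrow> y \<le> y')"
  (is "_ \<longleftrightarrow> ?P \<and> ?Q \<and> ?R")
proof
  assume A: "\<alpha> \<in> IC n"
  have D: "dom \<alpha> \<subseteq> {1..n}" and N: "ran \<alpha> \<subseteq> {1..n}" and I: "inj_on \<alpha> (dom \<alpha>)"
    and M: "\<forall>x\<in>dom \<alpha>. \<forall>y\<in>dom \<alpha>. x \<le> y \<longrightarrow> the (\<alpha> x) \<le> the (\<alpha> y)"
    and L: "\<forall>x\<in>dom \<alpha>. the (\<alpha> x) \<le> x"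
    using A unfolding IC_def mem_Collect_eq by - (elim conjE, assumption)+
  have d: "1 \<le> y \<and> y \<le> x \<and> x \<le> n" if h: "\<alpha> x = Some y" for x y
    using subsetD[OF D domI[of \<alpha>, OF h]] subsetD[OF N ranI[of \<alpha>, OF h]] bspec[OF L domI[of \<alpha>, OF h]] h by simp
  have i: "x = x'" if h: "\<alpha> x = Some y" "\<alpha> x' = Some y" for x x' y
    by (rule inj_onD[OF I _ domI[of \<alpha>, OF h(1)] domI[of \<alpha>, OF h(2)]]) (simp add: h)
  have m: "y \<le> y'" if h: "\<alpha> x = Some y" "\<alpha> x' = Some y'" "x \<le> x'" for x x' y y'
    using mp[OF bspec[OF bspec[OF M domI[of \<alpha>, OF h(1)]] domI[of \<alpha>, OF h(2)]] h(3)] h by simp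
  have ?P using d by blast
  moreover have ?Q using i by blast
  moreover have ?R using m by blast
  ultimately show "?P \<and> ?Q \<and> ?R" by blast
next
  assume A: "?P \<and> ?Q \<and> ?R"
  have P: "1 \<le> y \<and> y \<le> x \<and> x \<le> n" if "\<alpha> x = Some y" for x y
    using conjunct1[OF A] that by blast
  have "x \<in> {1..n}" "y \<in> {1..n}" if "\<alpha> x = Some y" for x y
    using P[OF that] by simp_all
  then have "dom \<alpha> \<subseteq> {1..n}" "ran \<alpha> \<subseteq> {1..n}"
    unfolding dom_def ran_def by blast+
  moreover have "inj_on \<alpha> (dom \<alpha>)"
  proof (rule inj_onI)
    fix x x' assume "x \<in> dom \<alpha>" "\<alpha> x = \<alpha> x'"
    then obtain y where "\<alpha> x = Some y" "\<alpha> x' = Some y" by (metis domD)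
    then show "x = x'" using conjunct1[OF conjunct2[OF A]] by blast
  qed
  moreover have "\<forall>x\<in>dom \<alpha>. \<forall>y\<in>dom \<alpha>. x \<le> y \<longrightarrow> the (\<alpha> x) \<le> the (\<alpha> y)"
  proof (intro ballI impI)
    fix x x' assume "x \<in> dom \<alpha>" "x' \<in> dom \<alpha>" "x \<le> x'"
    then obtain y y' where "\<alpha> x = Some y" "\<alpha> x' = Some y'" by blast
    then show "the (\<alpha> x) \<le> the (\<alpha> x')" using A \<open>x \<le> x'\<close> by simp
  qed
  moreover have "\<forall>x\<in>dom \<alpha>. the (\<alpha> x) \<le> x"
    using P by auto
  ultimately show "\<alpha> \<in> IC n" unfolding IC_def mem_Collect_eq by - (intro conjI; assumption)
qed

lemma pcomp_in_IC:
  assumes "\<alpha> \<in> IC n" "\<beta> \<in> IC n" shows "pcomp \<alpha> \<beta> \<in> IC n"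
proof -
  have P: "1 \<le> y \<and> y \<le> x \<and> x \<le> n"
    and Q: "\<gamma> x' = Some y \<Longrightarrow> x = x'"
    and R: "\<gamma> x' = Some y' \<Longrightarrow> x \<le> x' \<Longrightarrow> y \<le> y'"
    if "\<gamma> \<in> IC n" "\<gamma> x = Some y" for \<gamma> x x' y y'
    using that unfolding IC_iff by blast+
  have "1 \<le> z \<and> z \<le> x \<and> x \<le> n" if "\<alpha> x = Some y" "\<beta> y = Some z" for x y z
    using P[OF assms(1) that(1)] P[OF assms(2) that(2)] by linarith
  moreover have "x = x'"
    if "\<alpha> x = Some y" "\<beta> y = Some z" "\<alpha> x' = Some y'" "\<beta> y' = Some z" for x x' y y' z
    using Q[OF assms(2) that(2) that(4)] Q[OF assms(1) that(1)] that(3) by simp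
  moreover have "z \<le> z'"
    if "\<alpha> x = Some y" "\<beta> y = Some z" "\<alpha> x' = Some y'" "\<beta> y' = Some z'" "x \<le> x'" for x x' y y' z z'
    using R[OF assms(2) that(2) that(4) R[OF assms(1) that(1) that(3) that(5)]] .
  ultimately show ?thesis
    by (subst IC_iff) (unfold pcomp_eq_Some_iff, intro conjI allI impI; elim exE conjE; blast)
qed

lemma pcomp_assoc: "pcomp (pcomp \<alpha> \<beta>) \<gamma> = pcomp \<alpha> (pcomp \<beta> \<gamma>)"
  by (simp add: pcomp_def map_comp_def fun_eq_iff split: option.split)

lemma has_identity_IC: "has_identity (IC n) pcomp"
proof -
  let ?e = "\<lambda>x. if x \<in> {1..n} then Some x else None"
  have "?e \<in> IC n" by (auto simp: IC_iff split: if_splits)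
  moreover have "pcomp ?e \<alpha> = \<alpha> \<and> pcomp \<alpha> ?e = \<alpha>" if "\<alpha> \<in> IC n" for \<alpha>
  proof -
    have a: "1 \<le> y \<and> y \<le> x \<and> x \<le> n" if "\<alpha> x = Some y" for x y
      using \<open>\<alpha> \<in> IC n\<close> that by (simp add: IC_iff)
    have b: "\<alpha> x = None" if "x \<notin> {1..n}" for x
      using a[of x] that by (cases "\<alpha> x") force+
    have c: "y \<in> {1..n}" if "\<alpha> x = Some y" for x y
      using a[OF that] by simp
    have "pcomp ?e \<alpha> x = \<alpha> x" for x
      using b[of x] by (simp add: pcomp_def map_comp_def)
    moreover have "pcomp \<alpha> ?e x = \<alpha> x" for x
      using c[of x] by (cases "\<alpha> x") (simp_all add: pcomp_def map_comp_def)
    ultimately show ?thesis by (intro conjI ext)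
  qed
  ultimately show ?thesis unfolding has_identity_def by blast
qed

end

(* The restriction of the identity map to Im \<alpha> acts on \<alpha> from the right as the identity does, and
   so does its restriction to Dom \<alpha> from the left. Testing L* and R* on these pairs therefore
   recovers the image and the domain. Conversely, \<alpha>x = \<alpha>y says that x and y agree on Im \<alpha>, and
   x\<alpha> = y\<alpha> says, by injectivity, that x and y agree once corestricted to Dom \<alpha>. Finally, an
   isotone injection between finite chains is determined by its domain and image. *)
theory Submission
  imports Defs
begin

lemma
  assumes "\<alpha> \<in> IC n"
  shows dom_IC: "dom \<alpha> \<subseteq> {1..n}" and ran_IC: "ran \<alpha> \<subseteq> {1..n}" and inj_on_IC: "inj_on \<alpha> (dom \<alpha>)"
  using assms unfolding IC_def mem_Collect_eq by - (elim conjE, assumption)+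

lemma IC_isotone: "\<alpha> \<in> IC n \<Longrightarrow> \<alpha> x = Some y \<Longrightarrow> \<alpha> x' = Some y' \<Longrightarrow> x \<le> x' \<Longrightarrow> y \<le> y'"
  by (simp add: IC_iff)

text \<open>The identity map of \<open>{1..n}\<close> lies in \<open>IC n\<close>, so nothing is
  adjoined and the starred relations are tested on the monoid alone.\<close>

lemma adjoin1_IC: "adjoin1 (IC n) pcomp = Some ` IC n"
  by (simp add: adjoin1_def has_identity_IC)

lemma Lstar_IC_iff:
  "(\<alpha>, \<beta>) \<in> Lstar (IC n) pcomp \<longleftrightarrow> \<alpha> \<in> IC n \<and> \<beta> \<in> IC n \<and>
     (\<forall>x\<in>IC n. \<forall>y\<in>IC n. pcomp \<alpha> x = pcomp \<alpha> y \<longleftrightarrow> pcomp \<beta> x = pcomp \<beta> y)"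
  by (simp add: Lstar_def adjoin1_IC)

lemma Rstar_IC_iff:
  "(\<alpha>, \<beta>) \<in> Rstar (IC n) pcomp \<longleftrightarrow> \<alpha> \<in> IC n \<and> \<beta> \<in> IC n \<and>
     (\<forall>x\<in>IC n. \<forall>y\<in>IC n. pcomp x \<alpha> = pcomp y \<alpha> \<longleftrightarrow> pcomp x \<beta> = pcomp y \<beta>)"
  by (simp add: Rstar_def adjoin1_IC)

lemma partial_identity_in_IC: "A \<subseteq> {1..n} \<Longrightarrow> Some |` A \<in> IC n"
  by (auto simp: IC_iff restrict_map_def split: if_splits)

lemma pcomp_partial_identity_left: "pcomp (Some |` A) \<alpha> = \<alpha> |` A"
  by (auto simp: pcomp_def map_comp_def restrict_map_def)

lemma pcomp_partial_identity_right_eq_iff: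
  "pcomp \<alpha> (Some |` A) = \<alpha> \<longleftrightarrow> ran \<alpha> \<subseteq> A"
proof
  assume *: "pcomp \<alpha> (Some |` A) = \<alpha>"
  show "ran \<alpha> \<subseteq> A"
  proof
    fix y assume "y \<in> ran \<alpha>"
    then obtain x where "pcomp \<alpha> (Some |` A) x = Some y"
      unfolding * by (auto simp: ran_def)
    then show "y \<in> A"
      by (auto simp: pcomp_eq_Some_iff restrict_map_def split: if_splits)
  qed
next
  assume *: "ran \<alpha> \<subseteq> A"
  show "pcomp \<alpha> (Some |` A) = \<alpha>"
  proof
    fix z show "pcomp \<alpha> (Some |` A) z = \<alpha> z"
      using * by (cases "\<alpha> z") (auto simp: pcomp_def dest: ranI)
  qed
qed

lemma restrict_map_eq_self_iff: "\<alpha> |` A = \<alpha> \<longleftrightarrow> dom \<alpha> \<subseteq> A"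
proof
  assume "\<alpha> |` A = \<alpha>"
  then have "dom \<alpha> = dom \<alpha> \<inter> A" using dom_restrict[of \<alpha> A] by simp
  then show "dom \<alpha> \<subseteq> A" by blast
next
  assume "dom \<alpha> \<subseteq> A"
  then have "\<alpha> x = None" if "x \<notin> A" for x 
    using that domI[of \<alpha> x] by (cases "\<alpha> x") (simp, meson subsetD)
  then show "\<alpha> |` A = \<alpha>" by (simp add: restrict_map_def fun_eq_iff)
qed

text \<open>The right factor is evaluated only at points of the image, and each such point is
  reached. The equality thus depends on \<alpha> only through \<open>ran \<alpha>\<close>.\<close>

lemma pcomp_eq_iff:
  "pcomp \<alpha> x = pcomp \<alpha> y \<longleftrightarrow> (\<forall>u\<in>ran \<alpha>. x u = y u)"
proof
  assume *: "pcomp \<alpha> x = pcomp \<alpha> y"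
  show "\<forall>u\<in>ran \<alpha>. x u = y u"
  proof
    fix u assume "u \<in> ran \<alpha>"
    then obtain z where "\<alpha> z = Some u" by (auto simp: ran_def)
    with fun_cong[OF *, of z] show "x u = y u" by (simp add: pcomp_def)
  qed
next
  assume *: "\<forall>u\<in>ran \<alpha>. x u = y u"
  show "pcomp \<alpha> x = pcomp \<alpha> y"
  proof
    fix z show "pcomp \<alpha> x z = pcomp \<alpha> y z"
      using * by (cases "\<alpha> z") (simp_all add: pcomp_def ranI)
  qed
qed

lemma Lstar_IC_imp_ran_subset:
  assumes "(\<alpha>, \<beta>) \<in> Lstar (IC n) pcomp"
  shows "ran \<beta> \<subseteq> ran \<alpha>"
proof -
  have \<alpha>: "\<alpha> \<in> IC n" and \<beta>: "\<beta> \<in> IC n" using assms by (simp_all add: Lstar_IC_iff)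
  then have sub: "ran \<alpha> \<subseteq> {1..n}" "ran \<beta> \<subseteq> {1..n}" by - (rule ran_IC, assumption)+
  \<comment> \<open>The partial identity on \<open>{1..n}\<close> plays the role of 1. Both sets
    contain \<open>ran \<alpha>\<close>, so both products equal \<alpha>.\<close>
  have "pcomp \<alpha> (Some |` ran \<alpha>) = pcomp \<alpha> (Some |` {1..n})"
    using sub by (metis order_refl pcomp_partial_identity_right_eq_iff)
  then have "pcomp \<beta> (Some |` ran \<alpha>) = pcomp \<beta> (Some |` {1..n})"
    using assms sub by (simp add: Lstar_IC_iff partial_identity_in_IC)
  \<comment> \<open>The right-hand product is \<beta>, so the partial identity on
    \<open>ran \<alpha>\<close> fixes \<beta> from the right, which confines the image of
    \<beta>.\<close>
  then show ?thesis
    using sub by (metis pcomp_partial_identity_right_eq_iff)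
qed

lemma Rstar_IC_imp_dom_subset:
  assumes "(\<alpha>, \<beta>) \<in> Rstar (IC n) pcomp"
  shows "dom \<beta> \<subseteq> dom \<alpha>"
proof -
  have \<alpha>: "\<alpha> \<in> IC n" and \<beta>: "\<beta> \<in> IC n" using assms by (simp_all add: Rstar_IC_iff)
  then have sub: "dom \<alpha> \<subseteq> {1..n}" "dom \<beta> \<subseteq> {1..n}" by - (rule dom_IC, assumption)+
  \<comment> \<open>Left multiplication by a partial identity restricts the domain; neither
    restriction here changes \<alpha>.\<close>
  have "pcomp (Some |` dom \<alpha>) \<alpha> = pcomp (Some |` {1..n}) \<alpha>"
    using sub by (metis order_refl pcomp_partial_identity_left restrict_map_eq_self_iff)
  then have "pcomp (Some |` dom \<alpha>) \<beta> = pcomp (Some |` {1..n}) \<beta>"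
    using assms sub by (simp add: Rstar_IC_iff partial_identity_in_IC)
  then show ?thesis
    using sub by (metis pcomp_partial_identity_left restrict_map_eq_self_iff)
qed

lemma Lstar_IC_iff_ran:
  assumes "\<alpha> \<in> IC n" "\<beta> \<in> IC n"
  shows "(\<alpha>, \<beta>) \<in> Lstar (IC n) pcomp \<longleftrightarrow> ran \<alpha> = ran \<beta>"
proof
  assume *: "(\<alpha>, \<beta>) \<in> Lstar (IC n) pcomp"
  then have "(\<beta>, \<alpha>) \<in> Lstar (IC n) pcomp" by (simp add: Lstar_IC_iff)
  with * show "ran \<alpha> = ran \<beta>" by (intro equalityI Lstar_IC_imp_ran_subset)
qed (simp add: Lstar_IC_iff assms pcomp_eq_iff)

text \<open>By injectivity, a value of \<alpha> determines the point it came from, so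
  \<open>x\<close> and \<open>y\<close> agree wherever either one lands in
  \<open>dom \<alpha>\<close>, in particular wherever it lands in \<open>dom \<beta>\<close>. With
  equal domains the lemma applies in both directions.\<close>

lemma pcomp_cancel_dom_subset:
  assumes inj: "inj_on \<alpha> (dom \<alpha>)" and dom: "dom \<beta> \<subseteq> dom \<alpha>"
    and eq: "pcomp x \<alpha> = pcomp y \<alpha>"
  shows "pcomp x \<beta> = pcomp y \<beta>"
proof -
  \<comment> \<open>Here \<open>x\<close> and \<open>y\<close> are generalized anew, so that the
    claim also serves with the two exchanged.\<close>
  have "pcomp y \<beta> z = Some w"
    if xz: "pcomp x \<beta> z = Some w" and eq: "pcomp x \<alpha> = pcomp y \<alpha>" for x y z w
  proof -
    obtain u where u: "x z = Some u" "\<beta> u = Some w"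
      using xz by (auto simp: pcomp_eq_Some_iff)
    then obtain v where v: "\<alpha> u = Some v" using dom by (meson domD domI subsetD)
    then have "pcomp y \<alpha> z = Some v" using u(1) by (simp add: eq[symmetric] pcomp_eq_Some_iff)
    then obtain u' where u': "y z = Some u'" "\<alpha> u' = Some v"
      by (auto simp: pcomp_eq_Some_iff)
    then have "u' = u" using inj_onD[OF inj, of u' u] v by (simp add: domI)
    then show ?thesis using u u' by (simp add: pcomp_eq_Some_iff)
  qed
  from this[OF _ eq] this[OF _ eq[symmetric]]
  have "pcomp x \<beta> z = Some w \<longleftrightarrow> pcomp y \<beta> z = Some w" for z w
    by (rule iffI)
  then show ?thesis by (metis option.exhaust ext)
qed

lemma Rstar_IC_iff_dom:
  assumes "\<alpha> \<in> IC n" "\<beta> \<in> IC n"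
  shows "(\<alpha>, \<beta>) \<in> Rstar (IC n) pcomp \<longleftrightarrow> dom \<alpha> = dom \<beta>"
proof
  assume *: "(\<alpha>, \<beta>) \<in> Rstar (IC n) pcomp"
  then have "(\<beta>, \<alpha>) \<in> Rstar (IC n) pcomp" by (simp add: Rstar_IC_iff)
  with * show "dom \<alpha> = dom \<beta>" by (intro equalityI Rstar_IC_imp_dom_subset)
next
  assume "dom \<alpha> = dom \<beta>"
  then have "pcomp x \<alpha> = pcomp y \<alpha> \<longleftrightarrow> pcomp x \<beta> = pcomp y \<beta>" for x y
    using pcomp_cancel_dom_subset[OF inj_on_IC[OF assms(1)], of \<beta> x y]
      pcomp_cancel_dom_subset[OF inj_on_IC[OF assms(2)], of \<alpha> x y]
    by (intro iffI) simp_all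
  then show "(\<alpha>, \<beta>) \<in> Rstar (IC n) pcomp"
    using assms by (simp add: Rstar_IC_iff)
qed

lemma IC_eqI:
  assumes "\<alpha> \<in> IC n" "\<beta> \<in> IC n" and dom: "dom \<alpha> = dom \<beta>" and ran: "ran \<alpha> = ran \<beta>"
  shows "\<alpha> = \<beta>"
proof
  (* At the least point of disagreement, the smaller of the two values must be attained
     by the other map at an earlier point, where the maps agree. *)
  have le: "b \<le> a"
    if IC: "\<gamma> \<in> IC n" "\<delta> \<in> IC n" and ran: "ran \<gamma> = ran \<delta>" and IH: "\<And>x'. x' < x \<Longrightarrow> \<gamma> x' = \<delta> x'"
      and a: "\<gamma> x = Some a" and b: "\<delta> x = Some b" for \<gamma> \<delta> x a b
  proof -
    have "a \<in> ran \<delta>" using ranI[of \<gamma>, OF a] ran by simp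
    then obtain x' where x': "\<delta> x' = Some a" by (auto simp: ran_def)
    show ?thesis
    proof (cases "x \<le> x'")
      case True
      \<comment> \<open>\<delta> sends \<open>x\<close> to \<open>b\<close> and the later or equal
        point \<open>x'\<close> to \<open>a\<close>.\<close>
      then show ?thesis using IC_isotone[OF IC(2) b x'] by simp
    next
      case False
      \<comment> \<open>Below \<open>x\<close> the maps agree, so \<gamma> would take the value
        \<open>a\<close> at both \<open>x'\<close> and \<open>x\<close>, against
        injectivity.\<close>
      then have "\<gamma> x' = Some a" using IH x' by simp
      then have "x' = x" using inj_onD[OF inj_on_IC[OF IC(1)], of x' x] a by (simp add: domI)
      with False show ?thesis by simp
    qed
  qed
  fix x show "\<alpha> x = \<beta> x"
  proof (induction x rule: less_induct)
    case (less x)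
    show ?case
    proof (cases "\<alpha> x")
      case None
      then show ?thesis using dom by (metis domIff)
    next
      case (Some a)
      then obtain b where b: "\<beta> x = Some b" using dom by (metis domD domI)
      have "b \<le> a" by (rule le[OF assms(1,2) ran less.IH Some b])
      \<comment> \<open>The same claim with the two maps exchanged.\<close>
      moreover have "a \<le> b" by (rule le[OF assms(2,1) ran[symmetric] less.IH[symmetric] b Some])
      ultimately show ?thesis using Some b by simp
    qed
  qed
qed

theorem theorem2p9:
  fixes n :: nat and \<alpha> \<beta> :: "nat \<rightharpoonup> nat"
  assumes "n \<ge> 1" and "\<alpha> \<in> IC n" and "\<beta> \<in> IC n"
  shows "((\<alpha>, \<beta>) \<in> Lstar (IC n) pcomp \<longleftrightarrow> ran \<alpha> = ran \<beta>) \<and>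
         ((\<alpha>, \<beta>) \<in> Rstar (IC n) pcomp \<longleftrightarrow> dom \<alpha> = dom \<beta>) \<and>
         ((\<alpha>, \<beta>) \<in> Hstar (IC n) pcomp \<longleftrightarrow> \<alpha> = \<beta>)"
proof -
  note Lstar_IC_iff_ran[OF assms(2,3)] Rstar_IC_iff_dom[OF assms(2,3)]
  moreover have "ran \<alpha> = ran \<beta> \<and> dom \<alpha> = dom \<beta> \<longleftrightarrow> \<alpha> = \<beta>"
    by (rule iffI) (elim conjE, rule IC_eqI[OF assms(2,3)], assumption+, simp)
  ultimately show ?thesis by (simp only: Hstar_def Int_iff simp_thms)
qed

end
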